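(* Let $R$ be a commutative ring with $1\neq0$ and let $n>1$. Then, as monoids: (1) $\mathcal{MT}_n\cong \mathcal{ML}^n_n\rtimes\cdots\rtimes\mathcal{ML}^2_2\rtimes\mathcal{MP}(R)$; (2) $\mathcal{MT}_n\cong (R_{[n-1]}\rtimes UV(R_{[n-1]}))\rtimes\cdots\rtimes(R[x_1]\rtimes UV(R[x_1]))\rtimes\mathcal{MP}(R)$.
   Context: $R_{[k]}=R[x_1,\ldots,x_k]$. $UV(R_{[k]})$ is the multiplicative monoid of unit-valued polynomials, i.e. $g\in R_{[k]}$ with $g(a)\in R^\times$ for all $a\in R^k$. $\mathcal{MP}(R)$ is the monoid (under composition) of permutation polynomials on $R$, i.e. $f\in R[x_1]$ inducing a bijection of $R$. Composition of $n$-tuples: $\vec f\circ\vec g=(f_1(g_1,\ldots,g_n),\ldots,f_n(g_1,\ldots,g_n))$. For $n>1$, $\mathcal{MT}_n$ is the monoid under $\circ$ of all tuples $(f_1,f_2+x_2u_2,\ldots,f_n+x_nu_n)$ with $f_1\in\mathcal{MP}(R)$, $f_i\in R_{[i-1]}$, $u_i\in UV(R_{[i-1]})$ ($2\le i\le n$); $\mathcal{MT}_1=\mathcal{MP}(R)$. For $2\le k\le n$, $\mathcal{ML}^n_k$ is the submonoid of $\mathcal{MT}_n$ of elements $(k:u;f)=(x_1,\ldots,x_{k-1},f+x_ku,x_{k+1},\ldots,x_n)$ with $f\in R_{[k-1]}$, $u\in UV(R_{[k-1]})$. Semi-direct products of monoids: $B\rtimes A$ has underlying set $\{(a,b):a\in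 A,b\in B\}$ with product $(a,b)(c,d)=(ac,b\,\phi_a(d))$ when $A$ acts on $B$ from the left by monoid endomorphisms $\phi_a$, and $(a,b)(c,d)=(ac,\phi_c(b)d)$ when $A$ acts from the right. Convention: $A_1\rtimes A_2\rtimes A_3$ means $A_1\rtimes(A_2\rtimes A_3)$, and similarly for more factors. The actions are as follows. In $R_{[k-1]}\rtimes UV(R_{[k-1]})$ the additive group of $R_{[k-1]}$ is acted on from the left by multiplication, so $(u,f)(v,g)=(uv,f+ug)$; it is identified with $\mathcal{ML}^k_k$ via $(u,f)\leftrightarrow(k:u;f)$. In $\mathcal{ML}^k_k\rtimes\mathcal{MT}_{k-1}$, $\mathcal{MT}_{k-1}$ acts from the right by substitution, $(k:u;f)\mapsto(k:u(\vec h);f(\vec h))$ for $\vec h\in\mathcal{MT}_{k-1}$; in the iterated products the factor to the right of $\mathcal{ML}^k_k$ is identified with $\mathcal{MT}_{k-1}$. *)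

theory Defs
  imports "HOL-Library.Poly_Mapping" "HOL-Algebra.Weak_Morphisms"
begin

text \<open>The ring \<open>R\<close> is a type \<open>'a::comm_ring_1\<close>; that class includes \<open>0 \<noteq> 1\<close>.\<close>

section \<open>Polynomials\<close>

text \<open>Polynomials over \<open>'a\<close> in the variables \<open>x\<^sub>0, x\<^sub>1, x\<^sub>2, \<dots>\<close>, as finitely supported maps from
  exponent vectors to coefficients; the ring operations are those of \<^theory>\<open>HOL-Library.Poly_Mapping\<close>.
  Only \<open>x\<^sub>1, x\<^sub>2, \<dots>\<close> are used.\<close>

type_synonym 'a mpoly = "(nat \<Rightarrow>\<^sub>0 nat) \<Rightarrow>\<^sub>0 'a"

definition Const :: "'a::comm_ring_1 \<Rightarrow> 'a mpoly" where
  "Const c = Poly_Mapping.single 0 c"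

definition Var :: "nat \<Rightarrow> 'a::comm_ring_1 mpoly" where
  "Var i = Poly_Mapping.single (Poly_Mapping.single i 1) 1"

text \<open>Value at \<open>x\<^sub>i = g i\<close>, with coefficients transported along \<open>c\<close>.\<close>

definition insertion ::
    "('a::comm_ring_1 \<Rightarrow> 'b::comm_ring_1) \<Rightarrow> (nat \<Rightarrow> 'b) \<Rightarrow> 'a mpoly \<Rightarrow> 'b" where
  "insertion c g p =
     (\<Sum>m\<in>Poly_Mapping.keys p.
        c (Poly_Mapping.lookup p m) * (\<Prod>i\<in>Poly_Mapping.keys m. g i ^ Poly_Mapping.lookup m i))"

definition peval :: "(nat \<Rightarrow> 'a) \<Rightarrow> 'a::comm_ring_1 mpoly \<Rightarrow> 'a" where
  "peval = insertion (\<lambda>c. c)"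

definition psubst :: "(nat \<Rightarrow> 'a mpoly) \<Rightarrow> 'a::comm_ring_1 mpoly \<Rightarrow> 'a mpoly" where
  "psubst = insertion Const"

text \<open>\<open>polys k\<close> is \<open>R[x\<^sub>1, \<dots>, x\<^sub>k]\<close>.\<close>

definition polys :: "nat \<Rightarrow> 'a::comm_ring_1 mpoly set" where
  "polys k = {p. \<forall>m\<in>Poly_Mapping.keys p. Poly_Mapping.keys m \<subseteq> {1..k}}"

definition additive_group :: "nat \<Rightarrow> 'a::comm_ring_1 mpoly monoid" where
  "additive_group k = \<lparr>carrier = polys k, mult = (+), one = 0\<rparr>"

definition UV :: "nat \<Rightarrow> 'a::comm_ring_1 mpoly monoid" where
  "UV k = \<lparr>carrier = {g \<in> polys k. \<forall>a \<in> {1..k} \<rightarrow>\<^sub>E UNIV. peval a g dvd 1}, mult = (*), one = 1\<rparr>"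

definition MP :: "'a::comm_ring_1 mpoly monoid" where
  "MP = \<lparr>carrier = {f \<in> polys 1. bij (\<lambda>a. peval (\<lambda>_. a) f)},
         mult = (\<lambda>f g. psubst (\<lambda>_. g) f), one = Var 1\<rparr>"

section \<open>Tuples of polynomials\<close>

text \<open>An \<open>n\<close>-tuple is an extensional function on \<open>{1..n}\<close>.\<close>

type_synonym 'a tuple = "nat \<Rightarrow> 'a mpoly"

definition tuple_comp :: "nat \<Rightarrow> 'a::comm_ring_1 tuple \<Rightarrow> 'a tuple \<Rightarrow> 'a tuple" where
  "tuple_comp n f g = (\<lambda>i\<in>{1..n}. psubst g (f i))"

text \<open>\<open>MT 1\<close> consists of the 1-tuples with entry in \<open>MP\<close>.\<close>

definition MT :: "nat \<Rightarrow> 'a::comm_ring_1 tuple monoid" where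
  "MT n = \<lparr>carrier = {h \<in> extensional {1..n}. h 1 \<in> carrier MP \<and>
                       (\<forall>i\<in>{2..n}. \<exists>f\<in>polys (i - 1). \<exists>u\<in>carrier (UV (i - 1)). h i = f + Var i * u)},
           mult = tuple_comp n,
           one = (\<lambda>i\<in>{1..n}. Var i)\<rparr>"

text \<open>\<open>ml n k u f\<close> is the \<open>n\<close>-tuple \<open>(k:u;f)\<close>.\<close>

definition ml :: "nat \<Rightarrow> nat \<Rightarrow> 'a::comm_ring_1 mpoly \<Rightarrow> 'a mpoly \<Rightarrow> 'a tuple" where
  "ml n k u f = (\<lambda>i\<in>{1..n}. if i = k then f + Var k * u else Var i)"

definition MLin :: "nat \<Rightarrow> nat \<Rightarrow> 'a::comm_ring_1 tuple monoid" where
  "MLin n k = (MT n)\<lparr>carrier := {ml n k u f |u f. u \<in> carrier (UV (k - 1)) \<and> f \<in> polys (k - 1)}\<rparr>"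

section \<open>Semi-direct products of monoids\<close>

text \<open>Both constants build \<open>B \<rtimes> A\<close> on the pairs \<open>(a, b)\<close>, for a left and a right action of \<open>A\<close> on
  \<open>B\<close> respectively. Such a product is a monoid only if \<open>\<phi>\<close> is such an action by monoid endomorphisms.\<close>

definition semidirect_left ::
    "'b monoid \<Rightarrow> 'a monoid \<Rightarrow> ('a \<Rightarrow> 'b \<Rightarrow> 'b) \<Rightarrow> ('a \<times> 'b) monoid" where
  "semidirect_left B A \<phi> =
     \<lparr>carrier = carrier A \<times> carrier B,
      mult = (\<lambda>(a, b) (c, d). (a \<otimes>\<^bsub>A\<^esub> c, b \<otimes>\<^bsub>B\<^esub> \<phi> a d)),
      one = (\<one>\<^bsub>A\<^esub>, \<one>\<^bsub>B\<^esub>)\<rparr>"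

definition semidirect_right ::
    "'b monoid \<Rightarrow> 'a monoid \<Rightarrow> ('a \<Rightarrow> 'b \<Rightarrow> 'b) \<Rightarrow> ('a \<times> 'b) monoid" where
  "semidirect_right B A \<phi> =
     \<lparr>carrier = carrier A \<times> carrier B,
      mult = (\<lambda>(a, b) (c, d). (a \<otimes>\<^bsub>A\<^esub> c, \<phi> c b \<otimes>\<^bsub>B\<^esub> d)),
      one = (\<one>\<^bsub>A\<^esub>, \<one>\<^bsub>B\<^esub>)\<rparr>"

text \<open>The nested pairs forming the iterated products have a type depending on the number of
  factors. The datatype below is a common type for all of them: \<open>Base p\<close> stands for \<open>p\<close>, and
  \<open>Ext t b\<close> for the pair \<open>(t, b)\<close>.\<close>

datatype ('p, 'b) tower = Base 'p | Ext "('p, 'b) tower" 'b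

primrec factors :: "('p, 'b) tower \<Rightarrow> nat" where
  "factors (Base p) = 1"
| "factors (Ext t b) = Suc (factors t)"

text \<open>Identification of an iterated product with tuples of polynomials: \<open>coord k b\<close> is the
  \<open>k\<close>-th entry given by an element \<open>b\<close> of the factor of index \<open>k\<close>.\<close>

primrec tuple_of :: "(nat \<Rightarrow> 'b \<Rightarrow> 'a mpoly) \<Rightarrow> ('a::comm_ring_1 mpoly, 'b) tower \<Rightarrow> 'a tuple" where
  "tuple_of coord (Base p) = (\<lambda>i\<in>{1}. p)"
| "tuple_of coord (Ext t b) = (tuple_of coord t)(Suc (factors t) := coord (Suc (factors t)) b)"

text \<open>\<open>iterated_product B act coord n\<close> is \<open>B n \<rtimes> (B (n-1) \<rtimes> (\<dots> \<rtimes> (B 2 \<rtimes> MP)))\<close> for \<open>n \<ge> 1\<close>, where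
  \<open>act k h\<close> is the right action of a tuple \<open>h\<close> in \<open>MT (k-1)\<close> on \<open>B k\<close>. The value at \<open>0\<close> is
  irrelevant. The \<^const>\<open>image_group\<close> of an injective map is the isomorphic copy along it.\<close>

primrec iterated_product ::
    "(nat \<Rightarrow> 'b monoid) \<Rightarrow> (nat \<Rightarrow> 'a tuple \<Rightarrow> 'b \<Rightarrow> 'b) \<Rightarrow> (nat \<Rightarrow> 'b \<Rightarrow> 'a mpoly) \<Rightarrow> nat
     \<Rightarrow> ('a::comm_ring_1 mpoly, 'b) tower monoid" where
  "iterated_product B act coord 0 = image_group Base MP"
| "iterated_product B act coord (Suc k) =
     (if k = 0 then image_group Base MP
      else image_group (\<lambda>(t, b). Ext t b)
             (semidirect_right (B (Suc k)) (iterated_product B act coord k)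
                (\<lambda>t. act (Suc k) (tuple_of coord t))))"

section \<open>The two iterated products\<close>

text \<open>The action \<open>(k:u;f) \<mapsto> (k:u(h);f(h))\<close>; the pair \<open>(u, f)\<close> is recovered from the tuple.\<close>

definition elementary_act :: "nat \<Rightarrow> 'a::comm_ring_1 tuple \<Rightarrow> 'a tuple \<Rightarrow> 'a tuple" where
  "elementary_act k h b =
     (let (u, f) = inv_into (carrier (UV (k - 1)) \<times> polys (k - 1)) (\<lambda>(u, f). ml k k u f) b
      in ml k k (psubst h u) (psubst h f))"

definition elementary_product :: "nat \<Rightarrow> ('a::comm_ring_1 mpoly, 'a tuple) tower monoid" where
  "elementary_product = iterated_product (\<lambda>k. MLin k k) elementary_act (\<lambda>k b. b k)"

text \<open>\<open>R\<^bsub>[k]\<^esub> \<rtimes> UV(R\<^bsub>[k]\<^esub>)\<close>, with elements \<open>(u, f)\<close>.\<close>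

definition affine_monoid :: "nat \<Rightarrow> ('a::comm_ring_1 mpoly \<times> 'a mpoly) monoid" where
  "affine_monoid k = semidirect_left (additive_group k) (UV k) (\<lambda>u f. u * f)"

text \<open>The action and the entry below are those of \<open>(k:u;f)\<close>, with which \<open>(u, f)\<close> is identified.\<close>

definition affine_product :: "nat \<Rightarrow> ('a::comm_ring_1 mpoly, 'a mpoly \<times> 'a mpoly) tower monoid" where
  "affine_product =
     iterated_product (\<lambda>k. affine_monoid (k - 1)) (\<lambda>k h (u, f). (psubst h u, psubst h f))
       (\<lambda>k (u, f). f + Var k * u)"

end

theory Submission
  imports Defs
begin

text \<open>An \<open>(n+1)\<close>-tuple in \<open>MT (n+1)\<close> is the same as an \<open>n\<close>-tuple \<open>h\<close> in \<open>MT n\<close> together with a last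
  entry \<open>f + x\<^bsub>n+1\<^esub> u\<close>, and the pair \<open>(u, f)\<close> is determined by that entry. Composing \<open>(h, f + x\<^bsub>n+1\<^esub> u)\<close>
  with \<open>(h', g + x\<^bsub>n+1\<^esub> v)\<close> gives the last entry
  \<open>(f(h') + g u(h')) + x\<^bsub>n+1\<^esub> u(h') v\<close>, which is the product of \<open>(u(h'), f(h'))\<close> and \<open>(v, g)\<close> in the affine
  monoid. So \<^const>\<open>tuple_of\<close> is an isomorphism from either iterated product, one factor at a time,
  and the monoid laws of the products are pulled back from \<^const>\<open>MT\<close>.\<close>

section \<open>Evaluation and substitution\<close>

text \<open>An update at a key outside the support adds a single term, so induction over updates
  becomes induction over sums. Additive identities then need checking on single terms only, both for
  polynomials and for exponent vectors.\<close>

lemma poly_mapping_add_induct [case_names zero single add]: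
  fixes p :: "'k \<Rightarrow>\<^sub>0 'v::comm_monoid_add"
  assumes "P 0" and "\<And>m a. P (Poly_Mapping.single m a)" and "\<And>p q. P p \<Longrightarrow> P q \<Longrightarrow> P (p + q)"
  shows "P p"
proof (induction p rule: update_induct)
  case const
  show ?case by (rule assms(1))
next
  case (update f a b)
  have "Poly_Mapping.update a b f = f + Poly_Mapping.single a b"
    using update.hyps(1)
    by (intro poly_mapping_eqI)
       (auto simp: lookup_update lookup_add lookup_single in_keys_iff when_def)
  then show ?case using assms(2,3) update.IH by simp
qed

definition monom_value :: "(nat \<Rightarrow> 'b::comm_ring_1) \<Rightarrow> (nat \<Rightarrow>\<^sub>0 nat) \<Rightarrow> 'b" where
  "monom_value g m = (\<Prod>i\<in>Poly_Mapping.keys m. g i ^ Poly_Mapping.lookup m i)"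

text \<open>Indices outside the support contribute \<open>g i ^ 0 = 1\<close>. This allows two
  exponent vectors to be compared over a common index set.\<close>

lemma monom_value_superset:
  "finite S \<Longrightarrow> Poly_Mapping.keys m \<subseteq> S \<Longrightarrow> monom_value g m = (\<Prod>i\<in>S. g i ^ Poly_Mapping.lookup m i)"
  unfolding monom_value_def by (rule prod.mono_neutral_left) (auto simp: in_keys_iff)

lemma monom_value_add: "monom_value g (m + m') = monom_value g m * monom_value g m'"
proof -
  let ?S = "Poly_Mapping.keys m \<union> Poly_Mapping.keys m'"
  have "monom_value g (m + m') = (\<Prod>i\<in>?S. g i ^ Poly_Mapping.lookup (m + m') i)"
    by (rule monom_value_superset) (auto dest: subsetD[OF keys_add])
  also have "\<dots> = (\<Prod>i\<in>?S. g i ^ Poly_Mapping.lookup m i) * (\<Prod>i\<in>?S. g i ^ Poly_Mapping.lookup m' i)"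
    by (simp add: lookup_add power_add prod.distrib)
  also have "\<dots> = monom_value g m * monom_value g m'"
    by (simp add: monom_value_superset[where S = ?S])
  finally show ?thesis .
qed

lemma insertion_monom_value:
  "insertion c g p =
     (\<Sum>m\<in>Poly_Mapping.keys p. c (Poly_Mapping.lookup p m) * monom_value g m)"
  by (simp add: insertion_def monom_value_def)

text \<open>The coefficient map is the identity for \<open>peval\<close> and \<open>Const\<close>
  for \<open>psubst\<close>, so one development serves both. Both resulting maps on polynomials are
  again instances.\<close>

locale ring_map =
  fixes c :: "'a::comm_ring_1 \<Rightarrow> 'b::comm_ring_1"
  assumes map_add: "c (x + y) = c x + c y"
    and map_mult: "c (x * y) = c x * c y"
    and map_one: "c 1 = 1"
begin

lemma map_zero: "c 0 = 0"
  using map_add[of 0 0] by simp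

lemma map_sum: "c (sum f A) = (\<Sum>x\<in>A. c (f x))"
  by (induction A rule: infinite_finite_induct) (auto simp: map_zero map_add)

lemma map_power: "c (x ^ k) = c x ^ k"
  by (induction k) (auto simp: map_one map_mult)

lemma map_prod: "c (prod f A) = (\<Prod>x\<in>A. c (f x))"
  by (induction A rule: infinite_finite_induct) (auto simp: map_one map_mult)

lemma insertion_add: "insertion c g (p + q) = insertion c g p + insertion c g q"
  unfolding insertion_monom_value
  by (rule setsum_keys_plus_distrib) (simp_all add: map_zero map_add distrib_right)

lemma insertion_single: "insertion c g (Poly_Mapping.single m a) = c a * monom_value g m"
  by (simp add: insertion_monom_value map_zero)

lemma insertion_mult: "insertion c g (p * q) = insertion c g p * insertion c g q"
proof (induction p rule: poly_mapping_add_induct)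
  case zero
  show ?case by (simp add: insertion_def)
next
  case (single m a)
  show ?case
  proof (induction q rule: poly_mapping_add_induct)
    case zero
    show ?case by (simp add: insertion_def)
  next
    case (single m' b)
    show ?case by (simp add: mult_single insertion_single map_mult monom_value_add)
  next
    case (add p q)
    then show ?case by (simp add: distrib_left insertion_add)
  qed
next
  case (add p q)
  then show ?case by (simp add: distrib_right insertion_add)
qed

lemma insertion_Const: "insertion c g (Const a) = c a"
  by (simp add: Const_def insertion_single monom_value_def)

lemma insertion_Var: "insertion c g (Var i) = g i"
  by (simp add: Var_def insertion_single monom_value_def map_one)

lemma insertion_one: "insertion c g 1 = 1"
  using insertion_Const[of g 1] by (simp add: Const_def map_one)

lemma ring_map_insertion: "ring_map (insertion c g)"
  by unfold_locales (rule insertion_add insertion_mult insertion_one)+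

text \<open>A ring homomorphism passes through finite sums, products and powers. With
  \<open>c\<close> itself an evaluation or a substitution, this yields the composition laws
  \<open>peval_psubst\<close> and \<open>psubst_psubst\<close>.\<close>

lemma comp_insertion: "c (insertion d g p) = insertion (\<lambda>x. c (d x)) (\<lambda>i. c (g i)) p"
  by (simp add: insertion_def map_sum map_mult map_prod map_power)

end

interpretation id_map: ring_map "\<lambda>x::'a::comm_ring_1. x"
  by unfold_locales auto

interpretation Const_map: ring_map "Const :: 'a::comm_ring_1 \<Rightarrow> 'a mpoly"
  by unfold_locales (auto simp: Const_def single_add mult_single)

interpretation peval_map: ring_map "peval g :: 'a::comm_ring_1 mpoly \<Rightarrow> 'a"
  unfolding peval_def by (rule id_map.ring_map_insertion)

interpretation psubst_map: ring_map "psubst g :: 'a::comm_ring_1 mpoly \<Rightarrow> 'a mpoly"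
  unfolding psubst_def by (rule Const_map.ring_map_insertion)

lemmas psubst_simps =
  psubst_map.map_add psubst_map.map_mult psubst_map.map_zero psubst_map.map_one

lemma peval_Var: "peval g (Var i) = g i"
  by (simp add: peval_def id_map.insertion_Var)

lemma psubst_Var: "psubst g (Var i) = g i"
  by (simp add: psubst_def Const_map.insertion_Var)

lemma peval_psubst: "peval g (psubst h p) = peval (\<lambda>i. peval g (h i)) p"
  unfolding psubst_def peval_map.comp_insertion
  by (simp add: peval_def id_map.insertion_Const)

lemma psubst_psubst: "psubst g (psubst h p) = psubst (\<lambda>i. psubst g (h i)) p"
  using psubst_map.comp_insertion[of g Const h p]
  by (simp add: psubst_def Const_map.insertion_Const)

text \<open>Only \<open>g i\<close> for variables occurring in \<open>p\<close> enters the value.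
  Hence extensional tuples can serve as substitutions, whatever they are outside their index
  set.\<close>

lemma insertion_cong:
  assumes "p \<in> polys k" "\<And>i. i \<in> {1..k} \<Longrightarrow> g i = h i"
  shows "insertion c g p = insertion c h p"
  unfolding insertion_def
proof (intro sum.cong refl arg_cong2[where f = "(*)"] prod.cong)
  fix m i assume "m \<in> Poly_Mapping.keys p" "i \<in> Poly_Mapping.keys m"
  then have "i \<in> {1..k}" using assms(1) unfolding polys_def by blast
  then show "g i ^ Poly_Mapping.lookup m i = h i ^ Poly_Mapping.lookup m i"
    using assms(2) by simp
qed

lemma peval_cong: "p \<in> polys k \<Longrightarrow> (\<And>i. i \<in> {1..k} \<Longrightarrow> g i = h i) \<Longrightarrow> peval g p = peval h p"
  unfolding peval_def by (rule insertion_cong)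

lemma psubst_cong: "p \<in> polys k \<Longrightarrow> (\<And>i. i \<in> {1..k} \<Longrightarrow> g i = h i) \<Longrightarrow> psubst g p = psubst h p"
  unfolding psubst_def by (rule insertion_cong)

lemma Var_power: "Var i ^ e = Poly_Mapping.single (Poly_Mapping.single i e) 1"
  by (induction e) (simp_all add: Var_def mult_single flip: single_add)

text \<open>Both sides turn sums of exponent vectors into products, which leaves the powers of one
  variable.\<close>

lemma monom_value_Var: "monom_value Var m = Poly_Mapping.single m (1::'a::comm_ring_1)"
proof (induction m rule: poly_mapping_add_induct)
  case (single i e)
  then show ?case by (simp add: monom_value_def Var_power)
qed (simp_all add: monom_value_def[of _ 0] monom_value_add mult_single)

lemma psubst_Var_id: "psubst Var p = p"
proof (induction p rule: poly_mapping_add_induct)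
  case (single m a)
  show ?case
    by (simp add: psubst_def Const_map.insertion_single monom_value_Var Const_def mult_single)
qed (simp_all add: psubst_map.map_zero psubst_map.map_add)

lemma psubst_ident: "p \<in> polys k \<Longrightarrow> (\<And>i. i \<in> {1..k} \<Longrightarrow> g i = Var i) \<Longrightarrow> psubst g p = p"
  using psubst_cong[of p k g Var] by (simp add: psubst_Var_id)

section \<open>Closure properties of the polynomials in x_1, ..., x_k\<close>

lemma polys_zero: "0 \<in> polys k" and polys_one: "1 \<in> polys k" and polys_Const: "Const a \<in> polys k"
  by (simp_all add: polys_def Const_def)

lemma polys_Var: "i \<in> {1..k} \<Longrightarrow> Var i \<in> polys k"
  by (simp add: polys_def Var_def)

lemma polys_add: "p \<in> polys k \<Longrightarrow> q \<in> polys k \<Longrightarrow> p + q \<in> polys k"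
  unfolding polys_def using keys_add[of p q] by blast

lemma polys_mult:
  assumes "p \<in> polys k" "q \<in> polys k"
  shows "p * q \<in> polys k"
  unfolding polys_def
proof (intro CollectI ballI)
  fix m assume "m \<in> Poly_Mapping.keys (p * q)"
  from subsetD[OF keys_mult this]
  obtain a b where "m = a + b" "a \<in> Poly_Mapping.keys p" "b \<in> Poly_Mapping.keys q"
    by (elim CollectE exE conjE)
  with assms show "Poly_Mapping.keys m \<subseteq> {1..k}"
    using keys_add[of a b] unfolding polys_def by blast
qed

lemma polys_mono: "p \<in> polys k \<Longrightarrow> k \<le> l \<Longrightarrow> p \<in> polys l"
  by (force simp: polys_def)

lemma psubst_polys:
  assumes "p \<in> polys k" "\<And>i. i \<in> {1..k} \<Longrightarrow> g i \<in> polys l"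
  shows "psubst g p \<in> polys l"
proof -
  have sum: "sum f A \<in> polys l" if "\<And>x. x \<in> A \<Longrightarrow> f x \<in> polys l" for f :: "(nat \<Rightarrow>\<^sub>0 nat) \<Rightarrow> 'a mpoly" and A
    using that by (induction A rule: infinite_finite_induct) (auto intro: polys_zero polys_add)
  have prod: "prod f A \<in> polys l" if "\<And>x. x \<in> A \<Longrightarrow> f x \<in> polys l" for f :: "nat \<Rightarrow> 'a mpoly" and A
    using that by (induction A rule: infinite_finite_induct) (auto intro: polys_one polys_mult)
  have power: "q ^ e \<in> polys l" if "q \<in> polys l" for q :: "'a mpoly" and e
    using that by (induction e) (auto intro: polys_one polys_mult)
  show ?thesis
    unfolding psubst_def insertion_def
  proof (intro sum polys_mult polys_Const prod power assms(2))
    show "i \<in> {1..k}" if "m \<in> Poly_Mapping.keys p" "i \<in> Poly_Mapping.keys m" for m i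
      using assms(1) that unfolding polys_def by blast
  qed
qed

text \<open>Neither \<open>f\<close> nor \<open>u\<close> involves the variable of index
  \<open>k\<close>, so substituting \<open>q\<close> for it turns \<open>f + Var k * u\<close> into
  \<open>f + q * u\<close>. The choice \<open>q = 0\<close> recovers \<open>f\<close>, and
  \<open>q = 1\<close> then recovers \<open>u\<close>.\<close>

lemma affine_inject:
  assumes "f \<in> polys (k - 1)" "u \<in> polys (k - 1)" "f' \<in> polys (k - 1)" "u' \<in> polys (k - 1)"
    and "f + Var k * u = f' + Var k * u'"
  shows "f = f'" "u = u'"
proof -
  have subst: "psubst (Var(k := q)) (g + Var k * v) = g + q * v"
    if "g \<in> polys (k - 1)" "v \<in> polys (k - 1)" for g v q :: "'a mpoly"
  proof -
    have "psubst (Var(k := q)) r = r" if "r \<in> polys (k - 1)" for r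
      using that by (rule psubst_ident) auto
    then show ?thesis using that by (simp add: psubst_simps psubst_Var)
  qed
  show "f = f'"
    using arg_cong[OF assms(5), of "psubst (Var(k := 0))"] assms(1-4) by (simp add: subst)
  moreover have "f + u = f' + u'"
    using arg_cong[OF assms(5), of "psubst (Var(k := 1))"] assms(1-4) by (simp add: subst)
  ultimately show "u = u'" by simp
qed

section \<open>The monoid of triangular tuples\<close>

text \<open>Values depend on the first \<open>k\<close> arguments only, so extensional points may be
  replaced by arbitrary assignments; closure under substitution is then immediate.\<close>

lemma UV_carrier: "u \<in> carrier (UV k) \<longleftrightarrow> u \<in> polys k \<and> (\<forall>a. peval a u dvd 1)"
proof -
  have "peval a u dvd 1"
    if "u \<in> polys k" "\<forall>a\<in>{1..k} \<rightarrow>\<^sub>E UNIV. peval a u dvd 1" for a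
  proof -
    have "peval a u = peval (restrict a {1..k}) u"
      using that(1) by (rule peval_cong) simp
    moreover have "restrict a {1..k} \<in> {1..k} \<rightarrow>\<^sub>E UNIV" by simp
    ultimately show ?thesis using that(2) by metis
  qed
  then show ?thesis by (auto simp: UV_def)
qed

lemma UV_polys: "u \<in> carrier (UV k) \<Longrightarrow> u \<in> polys k"
  by (simp add: UV_carrier)

lemma UV_one: "1 \<in> carrier (UV k)"
  by (simp add: UV_carrier polys_one peval_map.map_one)

lemma UV_mult:
  assumes "u \<in> carrier (UV k)" "v \<in> carrier (UV k)"
  shows "u * v \<in> carrier (UV k)"
proof -
  have "peval a (u * v) dvd 1" for a
    using assms mult_dvd_mono[of "peval a u" 1 "peval a v" 1]
    by (simp add: UV_carrier peval_map.map_mult)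
  then show ?thesis using assms by (simp add: UV_carrier polys_mult)
qed

text \<open>By \<open>peval_psubst\<close>, each value of the substituted polynomial is a value of
  \<open>u\<close> at another point, hence a unit.\<close>

lemma UV_psubst:
  assumes "u \<in> carrier (UV k)" "\<And>i. i \<in> {1..k} \<Longrightarrow> g i \<in> polys l"
  shows "psubst g u \<in> carrier (UV l)"
  using assms(1) psubst_polys[OF UV_polys[OF assms(1)] assms(2)]
  by (simp add: UV_carrier peval_psubst)

text \<open>These are the entries that \<open>MT\<close> admits at index \<open>k \<ge> 2\<close>,
  and the common image of the \<open>k\<close>-th factors of both products.\<close>

definition affine_polys :: "nat \<Rightarrow> 'a::comm_ring_1 mpoly set" where
  "affine_polys k = {f + Var k * u |f u. f \<in> polys (k - 1) \<and> u \<in> carrier (UV (k - 1))}"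

lemma affine_polysI:
  "f \<in> polys (k - 1) \<Longrightarrow> u \<in> carrier (UV (k - 1)) \<Longrightarrow> f + Var k * u \<in> affine_polys k"
  by (auto simp: affine_polys_def)

lemma affine_polysE:
  assumes "p \<in> affine_polys k"
  obtains f u where "f \<in> polys (k - 1)" "u \<in> carrier (UV (k - 1))" "p = f + Var k * u"
  using assms by (auto simp: affine_polys_def)

lemma affine_polys_bij:
  "bij_betw (\<lambda>(u, f). f + Var k * u) (carrier (UV (k - 1)) \<times> polys (k - 1)) (affine_polys k)"
  unfolding bij_betw_def
proof
  show "inj_on (\<lambda>(u, f). f + Var k * u) (carrier (UV (k - 1)) \<times> polys (k - 1))"
    by (intro inj_onI) (clarify, metis affine_inject UV_polys)
  show "(\<lambda>(u, f). f + Var k * u) ` (carrier (UV (k - 1)) \<times> polys (k - 1)) = affine_polys k"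
    by (auto simp: affine_polys_def)
qed

lemma affine_polys_polys:
  assumes "p \<in> affine_polys k" "k \<in> {1..l}"
  shows "p \<in> polys l"
proof -
  obtain f u where "f \<in> polys (k - 1)" "u \<in> carrier (UV (k - 1))" "p = f + Var k * u"
    using assms(1) by (rule affine_polysE)
  moreover have "q \<in> polys l" if "q \<in> polys (k - 1)" for q :: "'a mpoly"
    using polys_mono[OF that, of l] assms(2) by auto
  ultimately show ?thesis
    using assms(2) by (auto intro!: polys_add polys_mult polys_Var dest: UV_polys)
qed

lemma Var_affine: "Var k \<in> affine_polys k"
  using affine_polysI[OF polys_zero UV_one, of k] by simp

text \<open>The polynomials \<open>f\<close> and \<open>u\<close> do not see the value at
  \<open>k\<close>, so only the explicit factor \<open>Var k\<close> is replaced by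
  \<open>g + Var k * v\<close>. The result is again affine, and its coefficients are the product of
  the pairs \<open>(psubst h u, psubst h f)\<close> and \<open>(v, g)\<close>. Both interpretations
  below rest on this computation.\<close>

lemma psubst_affine:
  assumes "f \<in> polys (k - 1)" "u \<in> polys (k - 1)"
  shows "psubst (h(k := g + Var k * v)) (f + Var k * u) =
    (psubst h f + g * psubst h u) + Var k * (psubst h u * v)"
proof -
  have "psubst (h(k := q)) p = psubst h p" if "p \<in> polys (k - 1)" for p q
    using that by (rule psubst_cong) auto
  then show ?thesis
    using assms by (simp add: psubst_simps psubst_Var algebra_simps)
qed

lemma affine_polys_psubst:
  assumes "p \<in> affine_polys k" "\<And>i. i \<in> {1..k - 1} \<Longrightarrow> h i \<in> polys (k - 1)" "h k \<in> affine_polys k"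
  shows "psubst h p \<in> affine_polys k"
proof -
  obtain f u where p: "f \<in> polys (k - 1)" "u \<in> carrier (UV (k - 1))" "p = f + Var k * u"
    using assms(1) by (rule affine_polysE)
  obtain g v where hk: "g \<in> polys (k - 1)" "v \<in> carrier (UV (k - 1))" "h k = g + Var k * v"
    using assms(3) by (rule affine_polysE)
  \<comment> \<open>Reading \<open>h\<close> as \<open>h(k := h k)\<close> brings the substitution
    into the form of \<open>psubst_affine\<close>.\<close>
  have "psubst h p = (psubst h f + g * psubst h u) + Var k * (psubst h u * v)"
    using psubst_affine[OF p(1) UV_polys[OF p(2)], of h g v] p(3) hk(3) by (metis fun_upd_triv)
  moreover have "psubst h u \<in> carrier (UV (k - 1))" "psubst h f \<in> polys (k - 1)"
    using UV_psubst[OF p(2) assms(2)] psubst_polys[OF p(1) assms(2)] by auto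
  ultimately show ?thesis
    using hk by (auto intro!: affine_polysI polys_add polys_mult UV_mult dest: UV_polys)
qed

section \<open>Permutation polynomials and composition of triangular tuples\<close>

lemma MP_polys: "f \<in> carrier MP \<Longrightarrow> f \<in> polys 1"
  by (simp add: MP_def)

lemma Var_MP: "Var 1 \<in> carrier MP"
  using bij_id by (simp add: MP_def polys_Var peval_Var id_def)

text \<open>Substitution of polynomials induces composition of the associated functions, and
  bijections compose.\<close>

lemma MP_closed:
  assumes "f \<in> carrier MP" "g \<in> carrier MP"
  shows "psubst (\<lambda>_. g) f \<in> carrier MP"
proof -
  have "(\<lambda>a. peval (\<lambda>_. a) (psubst (\<lambda>_. g) f)) = (\<lambda>a. peval (\<lambda>_. a) f) \<circ> (\<lambda>a. peval (\<lambda>_. a) g)"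
    by (simp add: peval_psubst comp_def)
  with assms show ?thesis
    by (auto simp: MP_def bij_comp intro: psubst_polys[of _ 1])
qed

lemma MT_carrier:
  "h \<in> carrier (MT n) \<longleftrightarrow>
    h \<in> extensional {1..n} \<and> h 1 \<in> carrier MP \<and> (\<forall>i\<in>{2..n}. h i \<in> affine_polys i)"
proof -
  have "(\<exists>f\<in>polys (i - 1). \<exists>u\<in>carrier (UV (i - 1)). h i = f + Var i * u) \<longleftrightarrow> h i \<in> affine_polys i" for i
    unfolding affine_polys_def by blast
  then show ?thesis by (simp add: MT_def del: One_nat_def)
qed

text \<open>Triangularity: entry \<open>i\<close> involves no variable of index above
  \<open>i\<close>, hence none above \<open>k\<close>.\<close>

lemma MT_polys:
  assumes "h \<in> carrier (MT n)" "i \<in> {1..k}" "k \<le> n"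
  shows "h i \<in> polys k"
proof (cases "i = 1")
  case True
  then show ?thesis
    using assms polys_mono[OF MP_polys, of "h 1" k] by (auto simp: MT_carrier)
next
  case False
  then have "h i \<in> affine_polys i"
    using assms by (auto simp: MT_carrier)
  then show ?thesis
    using assms(2) by (rule affine_polys_polys)
qed

lemma tuple_comp_closed:
  assumes "f \<in> carrier (MT n)" "g \<in> carrier (MT n)" "1 \<le> n"
  shows "tuple_comp n f g \<in> carrier (MT n)"
  unfolding MT_carrier
proof (intro conjI ballI)
  show "tuple_comp n f g \<in> extensional {1..n}"
    by (simp add: tuple_comp_def)
  \<comment> \<open>The first entry involves x_1 only, so substituting the whole tuple agrees with
    the multiplication of \<open>MP\<close>.\<close>
  have "psubst g (f 1) = psubst (\<lambda>_. g 1) (f 1)"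
    using assms(1) by (intro psubst_cong[of _ 1]) (auto simp: MT_carrier dest: MP_polys)
  then show "tuple_comp n f g 1 \<in> carrier MP"
    using assms by (simp add: tuple_comp_def MP_closed MT_carrier)
  show "tuple_comp n f g i \<in> affine_polys i" if "i \<in> {2..n}" for i
  proof -
    have "psubst g (f i) \<in> affine_polys i"
    proof (rule affine_polys_psubst)
      show "g j \<in> polys (i - 1)" if "j \<in> {1..i - 1}" for j
        using that \<open>i \<in> {2..n}\<close> by (intro MT_polys[OF assms(2)]) auto
    qed (use assms that in \<open>auto simp: MT_carrier\<close>)
    then show ?thesis using that by (simp add: tuple_comp_def)
  qed
qed

lemma monoid_MT:
  assumes "1 \<le> n"
  shows "monoid (MT n)"
proof (rule monoidI)
  have simps: "x \<otimes>\<^bsub>MT n\<^esub> y = tuple_comp n x y" "\<one>\<^bsub>MT n\<^esub> = (\<lambda>i\<in>{1..n}. Var i)" for x y :: "'a tuple"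
    by (simp_all add: MT_def)
  show "\<one>\<^bsub>MT n\<^esub> \<in> carrier (MT n)"
    using assms by (auto simp: simps MT_carrier Var_affine Var_MP[simplified])
  show "x \<otimes>\<^bsub>MT n\<^esub> y \<in> carrier (MT n)" if "x \<in> carrier (MT n)" "y \<in> carrier (MT n)" for x y :: "'a tuple"
    using that assms by (simp add: simps tuple_comp_closed)
  show "x \<otimes>\<^bsub>MT n\<^esub> y \<otimes>\<^bsub>MT n\<^esub> z = x \<otimes>\<^bsub>MT n\<^esub> (y \<otimes>\<^bsub>MT n\<^esub> z)"
    if "x \<in> carrier (MT n)" "y \<in> carrier (MT n)" "z \<in> carrier (MT n)" for x y z :: "'a tuple"
    unfolding simps tuple_comp_def
  proof (rule restrict_ext)
    fix i assume i: "i \<in> {1..n}"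
    have "psubst z (psubst y (x i)) = psubst (\<lambda>j. psubst z (y j)) (x i)"
      by (rule psubst_psubst)
    \<comment> \<open>The inner composite is cut off outside \<open>{1..n}\<close>; this is harmless
      because \<open>x i\<close> lies in \<open>polys n\<close>.\<close>
    also have "\<dots> = psubst (\<lambda>j\<in>{1..n}. psubst z (y j)) (x i)"
      using MT_polys[OF that(1) i order_refl] by (rule psubst_cong) simp
    finally show "psubst z ((\<lambda>i\<in>{1..n}. psubst y (x i)) i) = psubst (\<lambda>j\<in>{1..n}. psubst z (y j)) (x i)"
      using i by simp
  qed
  show "\<one>\<^bsub>MT n\<^esub> \<otimes>\<^bsub>MT n\<^esub> x = x" if "x \<in> carrier (MT n)" for x :: "'a tuple"
    using that by (intro extensionalityI[of _ "{1..n}"]) (auto simp: simps tuple_comp_def MT_carrier psubst_Var)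
  show "x \<otimes>\<^bsub>MT n\<^esub> \<one>\<^bsub>MT n\<^esub> = x" if "x \<in> carrier (MT n)" for x :: "'a tuple"
  proof (rule extensionalityI[of _ "{1..n}"])
    fix i assume i: "i \<in> {1..n}"
    have "psubst (\<lambda>i\<in>{1..n}. Var i) (x i) = x i"
      using MT_polys[OF that i order_refl] by (rule psubst_ident) simp
    then show "(x \<otimes>\<^bsub>MT n\<^esub> \<one>\<^bsub>MT n\<^esub>) i = x i"
      using i by (simp add: simps tuple_comp_def)
  qed (use that in \<open>auto simp: simps tuple_comp_def MT_carrier\<close>)
qed

text \<open>The condition on each entry mentions no other entry, so the last one can be split off
  freely. Since \<open>1 \<le> n\<close>, the entry split off is an affine one and the
  \<open>MP\<close> entry stays in the shorter tuple.\<close>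

lemma MT_Suc:
  assumes "1 \<le> n"
  shows "bij_betw (\<lambda>(h, p). h(Suc n := p)) (carrier (MT n) \<times> affine_polys (Suc n))
    (carrier (MT (Suc n) :: 'a::comm_ring_1 tuple monoid))"
proof (rule bij_betw_byWitness[where f' = "\<lambda>h. (restrict h {1..n}, h (Suc n))"])
  show "\<forall>x\<in>carrier (MT n) \<times> affine_polys (Suc n).
      (\<lambda>h. (restrict h {1..n}, h (Suc n))) ((\<lambda>(h, p). h(Suc n := p)) x) = x"
    by (auto simp: MT_carrier extensional_restrict)
  show "\<forall>h\<in>carrier (MT (Suc n) :: 'a tuple monoid).
      (\<lambda>(h, p). h(Suc n := p)) ((\<lambda>h. (restrict h {1..n}, h (Suc n))) h) = h"
  proof
    fix h :: "'a tuple" assume "h \<in> carrier (MT (Suc n))"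
    then have "h \<in> extensional {1..Suc n}" by (simp add: MT_carrier)
    then show "(\<lambda>(h, p). h(Suc n := p)) ((\<lambda>h. (restrict h {1..n}, h (Suc n))) h) = h"
      by (auto simp: fun_eq_iff extensional_def simp del: fun_upd_restrict)
  qed
  show "(\<lambda>(h, p). h(Suc n := p)) ` (carrier (MT n) \<times> affine_polys (Suc n)) \<subseteq> carrier (MT (Suc n))"
    using assms by (auto simp: MT_carrier extensional_def le_Suc_eq)
  show "(\<lambda>h. (restrict h {1..n}, h (Suc n))) ` carrier (MT (Suc n))
      \<subseteq> carrier (MT n) \<times> affine_polys (Suc n)"
    using assms by (auto simp: MT_carrier)
qed

section \<open>Iterated products\<close>

text \<open>Carriers formed by \<open>image_group\<close>, and that of \<open>MLin\<close>, are
  images of sets of pairs; this moves a bijection from the pairs to their image.\<close>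

lemma bij_betw_comp_image: "bij_betw (g \<circ> f) A C \<Longrightarrow> bij_betw g (f ` A) C"
  by (simp add: bij_betw_def inj_on_imageI image_comp)

text \<open>Each monoid law in \<open>G\<close> can be checked after applying the injective map
  \<open>f\<close>, where it becomes a law of \<open>H\<close>.\<close>

lemma monoid_transfer:
  assumes "monoid H" and bij: "bij_betw f (carrier G) (carrier H)"
    and one: "\<one>\<^bsub>G\<^esub> \<in> carrier G" "f \<one>\<^bsub>G\<^esub> = \<one>\<^bsub>H\<^esub>"
    and mult: "\<And>x y. x \<in> carrier G \<Longrightarrow> y \<in> carrier G \<Longrightarrow>
      x \<otimes>\<^bsub>G\<^esub> y \<in> carrier G \<and> f (x \<otimes>\<^bsub>G\<^esub> y) = f x \<otimes>\<^bsub>H\<^esub> f y"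
  shows "monoid G" "H \<cong> G"
proof -
  interpret H: monoid H by fact
  have inj: "x = y" if "x \<in> carrier G" "y \<in> carrier G" "f x = f y" for x y
    using bij that by (auto simp: bij_betw_def inj_on_def)
  have f: "f x \<in> carrier H" if "x \<in> carrier G" for x
    using bij that by (auto simp: bij_betw_def)
  show "monoid G"
    by (rule monoidI) (auto intro!: inj simp: one mult f H.m_assoc)
  \<comment> \<open>The inverse of \<open>f\<close> has the required direction. It is multiplicative
    because both sides have the same image under \<open>f\<close>.\<close>
  let ?g = "inv_into (carrier G) f"
  have g: "?g y \<in> carrier G" "f (?g y) = y" if "y \<in> carrier H" for y
    using bij that by (auto simp: bij_betw_def inv_into_into f_inv_into_f)
  have "?g \<in> iso H G"
    unfolding iso_def hom_def using bij_betw_inv_into[OF bij]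
    by (auto intro!: inj simp: g mult)
  then show "H \<cong> G" by (auto simp: is_iso_def)
qed

text \<open>This collects what the two families of factors share. \<open>coord k\<close> identifies
  \<open>B k\<close> with the admissible entries at \<open>k\<close>, and \<open>act_mult\<close>
  says that acting and then multiplying in \<open>B k\<close> computes the last entry of a composite
  of \<open>k\<close>-tuples. Index 1 is left to \<open>MP\<close>.\<close>

locale triangular_factors =
  fixes B :: "nat \<Rightarrow> 'b monoid"
    and act :: "nat \<Rightarrow> 'a::comm_ring_1 tuple \<Rightarrow> 'b \<Rightarrow> 'b"
    and coord :: "nat \<Rightarrow> 'b \<Rightarrow> 'a mpoly"
  assumes coord_bij: "2 \<le> k \<Longrightarrow> bij_betw (coord k) (carrier (B k)) (affine_polys k)"
    and coord_one: "2 \<le> k \<Longrightarrow> \<one>\<^bsub>B k\<^esub> \<in> carrier (B k) \<and> coord k \<one>\<^bsub>B k\<^esub> = Var k"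
    and act_mult: "\<lbrakk>2 \<le> k; h \<in> carrier (MT (k - 1)); b \<in> carrier (B k); d \<in> carrier (B k)\<rbrakk> \<Longrightarrow>
      act k h b \<otimes>\<^bsub>B k\<^esub> d \<in> carrier (B k) \<and>
      coord k (act k h b \<otimes>\<^bsub>B k\<^esub> d) = psubst (h(k := coord k d)) (coord k b)"
begin

abbreviation P :: "nat \<Rightarrow> ('a mpoly, 'b) tower monoid" where
  "P \<equiv> iterated_product B act coord"

lemma product_1:
  "carrier (P (Suc 0)) = Base ` carrier MP"
  "\<one>\<^bsub>P (Suc 0)\<^esub> = Base (Var 1)"
  "\<lbrakk>f \<in> carrier MP; g \<in> carrier MP\<rbrakk> \<Longrightarrow> Base f \<otimes>\<^bsub>P (Suc 0)\<^esub> Base g = Base (psubst (\<lambda>_. g) f)"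
proof -
  have "inj_on (Base :: _ \<Rightarrow> ('a mpoly, 'b) tower) (carrier MP)" by (auto intro: inj_onI)
  then show "\<lbrakk>f \<in> carrier MP; g \<in> carrier MP\<rbrakk> \<Longrightarrow> Base f \<otimes>\<^bsub>P (Suc 0)\<^esub> Base g = Base (psubst (\<lambda>_. g) f)"
    by (simp add: image_group_def) (simp add: MP_def)
qed (simp_all add: image_group_def MP_def)

text \<open>Multiplication in \<open>image_group\<close> goes through \<open>inv_into\<close>;
  injectivity of the pairing \<open>Ext\<close> evaluates it on the carrier. The bound
  \<open>1 \<le> n\<close> selects the semi-direct branch of the recursion.\<close>

lemma product_Suc:
  assumes "1 \<le> n"
  shows "carrier (P (Suc n)) = (\<lambda>(t, b). Ext t b) ` (carrier (P n) \<times> carrier (B (Suc n)))"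
    and "\<one>\<^bsub>P (Suc n)\<^esub> = Ext \<one>\<^bsub>P n\<^esub> \<one>\<^bsub>B (Suc n)\<^esub>"
    and "\<lbrakk>t \<in> carrier (P n); b \<in> carrier (B (Suc n)); s \<in> carrier (P n); d \<in> carrier (B (Suc n))\<rbrakk> \<Longrightarrow>
      Ext t b \<otimes>\<^bsub>P (Suc n)\<^esub> Ext s d =
        Ext (t \<otimes>\<^bsub>P n\<^esub> s) (act (Suc n) (tuple_of coord s) b \<otimes>\<^bsub>B (Suc n)\<^esub> d)"
proof -
  have inv: "inv_into (carrier (P n) \<times> carrier (B (Suc n))) (\<lambda>(t, b). Ext t b) (Ext t b) = (t, b)"
    if "t \<in> carrier (P n)" "b \<in> carrier (B (Suc n))" for t b
    using that by (intro inv_into_f_eq) (auto intro!: inj_onI)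
  show "\<lbrakk>t \<in> carrier (P n); b \<in> carrier (B (Suc n)); s \<in> carrier (P n); d \<in> carrier (B (Suc n))\<rbrakk> \<Longrightarrow>
      Ext t b \<otimes>\<^bsub>P (Suc n)\<^esub> Ext s d =
        Ext (t \<otimes>\<^bsub>P n\<^esub> s) (act (Suc n) (tuple_of coord s) b \<otimes>\<^bsub>B (Suc n)\<^esub> d)"
    using assms by (simp add: image_group_def semidirect_right_def inv)
qed (use assms in \<open>simp_all add: image_group_def semidirect_right_def\<close>)

text \<open>Induction on \<open>n\<close>, carrying everything that \<open>monoid_transfer\<close>
  asks for. The count \<open>factors t = n\<close> is included because \<open>tuple_of\<close> takes
  the index of a new entry from the tower itself.\<close>

lemma product_iso:
  assumes "1 \<le> n"
  shows "(\<forall>t\<in>carrier (P n). factors t = n) \<and>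
    bij_betw (tuple_of coord) (carrier (P n)) (carrier (MT n)) \<and>
    \<one>\<^bsub>P n\<^esub> \<in> carrier (P n) \<and> tuple_of coord \<one>\<^bsub>P n\<^esub> = \<one>\<^bsub>MT n\<^esub> \<and>
    (\<forall>t\<in>carrier (P n). \<forall>s\<in>carrier (P n). t \<otimes>\<^bsub>P n\<^esub> s \<in> carrier (P n) \<and>
      tuple_of coord (t \<otimes>\<^bsub>P n\<^esub> s) = tuple_of coord t \<otimes>\<^bsub>MT n\<^esub> tuple_of coord s)"
  using assms
proof (induction n rule: dec_induct)
  case base
  have bij: "bij_betw (tuple_of coord) (Base ` carrier MP) (carrier (MT 1))"
    by (rule bij_betw_byWitness[where f' = "\<lambda>h. Base (h 1)"])
       (auto simp: MT_carrier intro!: extensionalityI[of _ "{Suc 0}"])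
  \<comment> \<open>For 1-tuples the only variable that can occur is x_1, so composition of tuples
    is substitution into one polynomial.\<close>
  have "(\<lambda>i\<in>{1}. psubst (\<lambda>_. g) f) = tuple_comp 1 (\<lambda>i\<in>{1}. f) (\<lambda>i\<in>{1}. g)"
    if "f \<in> carrier MP" for f g :: "'a mpoly"
    using MP_polys[OF that] by (auto simp: tuple_comp_def fun_eq_iff intro!: psubst_cong[of _ 1])
  then show ?case
    using bij Var_MP
    by (auto simp: product_1 MP_closed MT_def simp del: iterated_product.simps)
next
  case (step n)
  let ?T = "tuple_of coord" and ?k = "Suc n"
  note P = product_Suc[OF step.hyps(1)]
  have k: "2 \<le> ?k" using step.hyps by simp
  note [simp del] = iterated_product.simps
  have factors: "factors t = n" if "t \<in> carrier (P n)" for t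
    using step.IH that by blast
  have T: "?T t \<in> carrier (MT n)" if "t \<in> carrier (P n)" for t
    using step.IH that by (auto simp: bij_betw_def)
  have T_Ext: "?T (Ext t b) = (?T t)(?k := coord ?k b)" if "t \<in> carrier (P n)" for t b
    using factors[OF that] by simp
  have "bij_betw (map_prod ?T (coord ?k)) (carrier (P n) \<times> carrier (B ?k)) (carrier (MT n) \<times> affine_polys ?k)"
    using step.IH coord_bij[OF k] by (intro bij_betw_map_prod) auto
  \<comment> \<open>The composed bijection sends \<open>(t, b)\<close> to
    \<open>?T (Ext t b)\<close>, because \<open>t\<close> has exactly \<open>n\<close>
    factors.\<close>
  from bij_betw_trans[OF this MT_Suc[OF step.hyps(1)]]
  have "bij_betw (?T \<circ> (\<lambda>(t, b). Ext t b)) (carrier (P n) \<times> carrier (B ?k)) (carrier (MT ?k))"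
    by (rule bij_betw_cong[THEN iffD1, rotated]) (auto simp: factors)
  then have bij: "bij_betw ?T (carrier (P ?k)) (carrier (MT ?k))"
    unfolding P(1) by (rule bij_betw_comp_image)
  have one: "?T \<one>\<^bsub>P ?k\<^esub> = \<one>\<^bsub>MT ?k\<^esub>"
    using step.IH coord_one[OF k] by (auto simp: P(2) factors MT_def)
  have mult: "Ext t b \<otimes>\<^bsub>P ?k\<^esub> Ext s d \<in> carrier (P ?k) \<and>
      ?T (Ext t b \<otimes>\<^bsub>P ?k\<^esub> Ext s d) = ?T (Ext t b) \<otimes>\<^bsub>MT ?k\<^esub> ?T (Ext s d)"
    if tb: "t \<in> carrier (P n)" "b \<in> carrier (B ?k)" and sd: "s \<in> carrier (P n)" "d \<in> carrier (B ?k)"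
    for t b s d
  proof -
    let ?c = "act ?k (?T s) b \<otimes>\<^bsub>B ?k\<^esub> d"
    have c: "?c \<in> carrier (B ?k)" "coord ?k ?c = psubst ((?T s)(?k := coord ?k d)) (coord ?k b)"
      using act_mult[OF k, of "?T s" b d] T[OF sd(1)] tb sd by auto
    have ts: "t \<otimes>\<^bsub>P n\<^esub> s \<in> carrier (P n)" "?T (t \<otimes>\<^bsub>P n\<^esub> s) = tuple_comp n (?T t) (?T s)"
      using step.IH tb sd by (auto simp: MT_def)
    \<comment> \<open>The first \<open>n\<close> entries do not involve the new variable, so
      appending an entry to the inner tuple leaves their composites unchanged. The new entry itself
      is governed by \<open>act_mult\<close>.\<close>
    have lower: "psubst (?T s) (?T t i) = psubst ((?T s)(?k := coord ?k d)) (?T t i)" if "i \<in> {1..n}" for i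
      using MT_polys[OF T[OF tb(1)] that order_refl] by (rule psubst_cong) auto
    have "?T (Ext (t \<otimes>\<^bsub>P n\<^esub> s) ?c) = (tuple_comp n (?T t) (?T s))(?k := coord ?k ?c)"
      by (simp only: T_Ext[OF ts(1)] ts(2))
    also have "\<dots> = tuple_comp ?k (?T (Ext t b)) (?T (Ext s d))"
      unfolding T_Ext[OF tb(1)] T_Ext[OF sd(1)] c(2) using lower
      by (auto simp: tuple_comp_def fun_eq_iff le_Suc_eq)
    finally show ?thesis
      using ts(1) c(1) by (auto simp: P(3)[OF tb sd] P(1) MT_def)
  qed
  show ?case
    using bij one mult step.IH coord_one[OF k] by (auto simp: P(1) P(2) factors)
qed

theorem product_MT:
  assumes "1 \<le> n"
  shows "monoid (P n)" "(MT n :: 'a tuple monoid) \<cong> P n"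
proof -
  note iso = product_iso[OF assms]
  show "monoid (P n)"
    by (rule monoid_transfer(1)[OF monoid_MT[OF assms], of "tuple_of coord"]) (use iso in blast)+
  show "(MT n :: 'a tuple monoid) \<cong> P n"
    by (rule monoid_transfer(2)[OF monoid_MT[OF assms], of "tuple_of coord"]) (use iso in blast)+
qed

end

section \<open>The factors R_[k-1] \<rtimes> UV(R_[k-1])\<close>

lemma MT_act:
  assumes "2 \<le> k" "h \<in> carrier (MT (k - 1))" "u \<in> carrier (UV (k - 1))" "f \<in> polys (k - 1)"
  shows "psubst h u \<in> carrier (UV (k - 1))" "psubst h f \<in> polys (k - 1)"
  using UV_psubst[OF assms(3)] psubst_polys[OF assms(4)] MT_polys[OF assms(2)] by auto

interpretation affine: triangular_factors "\<lambda>k. affine_monoid (k - 1)"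
  "\<lambda>k h (u, f). (psubst h u, psubst h f)"
  "\<lambda>k (u, f). f + Var k * u :: 'a::comm_ring_1 mpoly"
proof
  fix k :: nat assume k: "2 \<le> k"
  show "bij_betw (\<lambda>(u, f). f + Var k * u :: 'a mpoly) (carrier (affine_monoid (k - 1))) (affine_polys k)"
    using affine_polys_bij[of k] by (simp add: affine_monoid_def semidirect_left_def additive_group_def)
  show "\<one>\<^bsub>affine_monoid (k - 1)\<^esub> \<in> carrier (affine_monoid (k - 1)) \<and>
      (case \<one>\<^bsub>affine_monoid (k - 1)\<^esub> of (u, f) \<Rightarrow> f + Var k * u) = (Var k :: 'a mpoly)"
    using UV_one polys_zero
    by (auto simp: affine_monoid_def semidirect_left_def additive_group_def UV_def)
  fix h :: "'a tuple" and b d :: "'a mpoly \<times> 'a mpoly"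
  assume h: "h \<in> carrier (MT (k - 1))"
    and "b \<in> carrier (affine_monoid (k - 1))" "d \<in> carrier (affine_monoid (k - 1))"
  then obtain u f v g where b: "b = (u, f)" "u \<in> carrier (UV (k - 1))" "f \<in> polys (k - 1)"
    and d: "d = (v, g)" "v \<in> carrier (UV (k - 1))" "g \<in> polys (k - 1)"
    by (auto simp: affine_monoid_def semidirect_left_def additive_group_def)
  \<comment> \<open>This is the rule \<open>(u, f)(v, g) = (u * v, f + u * g)\<close> after
    \<open>h\<close> has acted on the first pair, and matches the coefficients in
    \<open>psubst_affine\<close> up to commuting factors.\<close>
  have prod: "(case b of (u, f) \<Rightarrow> (psubst h u, psubst h f)) \<otimes>\<^bsub>affine_monoid (k - 1)\<^esub> d =
      (psubst h u * v, psubst h f + psubst h u * g)"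
    by (simp add: b d affine_monoid_def semidirect_left_def additive_group_def UV_def)
  show "(case b of (u, f) \<Rightarrow> (psubst h u, psubst h f)) \<otimes>\<^bsub>affine_monoid (k - 1)\<^esub> d
        \<in> carrier (affine_monoid (k - 1)) \<and>
      (case (case b of (u, f) \<Rightarrow> (psubst h u, psubst h f)) \<otimes>\<^bsub>affine_monoid (k - 1)\<^esub> d of
        (u, f) \<Rightarrow> f + Var k * u) =
      psubst (h(k := case d of (u, f) \<Rightarrow> f + Var k * u)) (case b of (u, f) \<Rightarrow> f + Var k * u)"
    unfolding prod
    using MT_act[OF k h b(2,3)] b d psubst_affine[OF b(3) UV_polys[OF b(2)], of h g v]
    by (auto simp: affine_monoid_def semidirect_left_def additive_group_def mult.commute[of g]
          intro!: UV_mult polys_add polys_mult dest: UV_polys)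
qed

section \<open>The factors of elementary tuples (k:u;f)\<close>

lemma ml_entry: "1 \<le> k \<Longrightarrow> ml k k u f k = f + Var k * u"
  by (simp add: ml_def)

text \<open>Entry \<open>k\<close> is the only one that depends on \<open>u\<close> and
  \<open>f\<close>, so reading it off reduces the claim to \<open>affine_polys_bij\<close>.\<close>

lemma ml_affine_bij:
  assumes "1 \<le> k"
  shows "bij_betw ((\<lambda>b. b k) \<circ> (\<lambda>(u, f). ml k k u f)) (carrier (UV (k - 1)) \<times> polys (k - 1)) (affine_polys k)"
  by (rule bij_betw_cong[THEN iffD1, OF _ affine_polys_bij]) (auto simp: ml_entry[OF assms])

lemma elementary_act_ml:
  assumes "1 \<le> k" "u \<in> carrier (UV (k - 1))" "f \<in> polys (k - 1)"
  shows "elementary_act k h (ml k k u f) = ml k k (psubst h u) (psubst h f)"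
proof -
  \<comment> \<open>The pair is recovered correctly because \<open>(u, f)\<close> is determined by
    entry \<open>k\<close>: injectivity of the composite with reading that entry gives injectivity
    of \<open>ml k k\<close>.\<close>
  have "inv_into (carrier (UV (k - 1)) \<times> polys (k - 1)) (\<lambda>(u, f). ml k k u f) (ml k k u f) = (u, f)"
    using assms(2,3) inj_on_imageI2[OF bij_betw_imp_inj_on[OF ml_affine_bij[OF assms(1)]]]
    by (intro inv_into_f_eq) auto
  then show ?thesis by (simp add: elementary_act_def)
qed

text \<open>The entries below \<open>k\<close> are variables in both tuples, and entry
  \<open>k\<close> is \<open>psubst_affine\<close> at the identity substitution. This is the
  identification of (k:u;f) with the pair \<open>(u, f)\<close> at the level of products.\<close>

lemma tuple_comp_ml:
  assumes "1 \<le> k" "u \<in> polys (k - 1)" "f \<in> polys (k - 1)"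
  shows "tuple_comp k (ml k k u f) (ml k k v g) = ml k k (u * v) (f + u * g)"
proof -
  \<comment> \<open>On the indices \<open>1..k\<close> the tuple \<open>ml k k v g\<close> agrees
    with \<open>Var\<close> altered at \<open>k\<close>, and no other variables occur.\<close>
  have "psubst (ml k k v g) (f + Var k * u) = psubst (Var(k := g + Var k * v)) (f + Var k * u)"
  proof (rule psubst_cong[of _ k])
    show "f + Var k * u \<in> polys k"
      using assms by (intro polys_add polys_mult polys_Var) (auto intro: polys_mono[of _ "k - 1"])
  qed (auto simp: ml_def)
  also have "\<dots> = (f + u * g) + Var k * (u * v)"
    using psubst_affine[OF assms(3,2), of Var g v] by (simp add: psubst_Var_id mult.commute)
  finally show ?thesis
    by (auto simp: tuple_comp_def ml_def fun_eq_iff psubst_Var)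
qed

interpretation elementary: triangular_factors "\<lambda>k. MLin k k" elementary_act
  "\<lambda>k b. b k :: 'a::comm_ring_1 mpoly"
proof
  fix k :: nat assume k: "2 \<le> k"
  have carrier: "carrier (MLin k k) = {ml k k u f |u f. u \<in> carrier (UV (k - 1)) \<and> f \<in> polys (k - 1)}"
    by (simp add: MLin_def)
  have entry: "ml k k u f k = f + Var k * u" for u f :: "'a mpoly"
    using k by (simp add: ml_entry)
  show "bij_betw (\<lambda>b. b k :: 'a mpoly) (carrier (MLin k k)) (affine_polys k)"
  proof -
    have "carrier (MLin k k) = (\<lambda>(u, f). ml k k u f) ` (carrier (UV (k - 1)) \<times> polys (k - 1) :: ('a mpoly \<times> 'a mpoly) set)"
      by (auto simp: carrier)
    then show ?thesis
      using bij_betw_comp_image[OF ml_affine_bij[of k]] k by simp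
  qed
  have "\<one>\<^bsub>MLin k k\<^esub> = (ml k k 1 0 :: 'a tuple)"
    by (auto simp: MLin_def MT_def ml_def)
  moreover have "ml k k 1 0 \<in> (carrier (MLin k k) :: 'a tuple set)"
    unfolding carrier using UV_one polys_zero by blast
  ultimately show "\<one>\<^bsub>MLin k k\<^esub> \<in> (carrier (MLin k k) :: 'a tuple set) \<and> \<one>\<^bsub>MLin k k\<^esub> k = (Var k :: 'a mpoly)"
    by (simp add: entry)
  fix h b d :: "'a tuple"
  assume h: "h \<in> carrier (MT (k - 1))" and "b \<in> carrier (MLin k k)" "d \<in> carrier (MLin k k)"
  then obtain u f v g where b: "b = ml k k u f" "u \<in> carrier (UV (k - 1))" "f \<in> polys (k - 1)"
    and d: "d = ml k k v g" "v \<in> carrier (UV (k - 1))" "g \<in> polys (k - 1)"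
    by (auto simp: carrier)
  note act = MT_act[OF k h b(2,3)]
  \<comment> \<open>The action keeps the tuple elementary, so the product reduces to
    \<open>tuple_comp_ml\<close> with \<open>psubst h u\<close> and \<open>psubst h f\<close> as
    coefficients.\<close>
  have prod: "elementary_act k h b \<otimes>\<^bsub>MLin k k\<^esub> d =
      ml k k (psubst h u * v) (psubst h f + psubst h u * g)"
    using k act b d tuple_comp_ml[of k "psubst h u" "psubst h f" v g]
    by (simp add: elementary_act_ml MLin_def MT_def UV_polys)
  have "ml k k (psubst h u * v) (psubst h f + psubst h u * g) \<in> carrier (MLin k k)"
    unfolding carrier using act d by (blast intro: UV_mult polys_add polys_mult UV_polys)
  then show "elementary_act k h b \<otimes>\<^bsub>MLin k k\<^esub> d \<in> carrier (MLin k k) \<and>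
      (elementary_act k h b \<otimes>\<^bsub>MLin k k\<^esub> d) k = psubst (h(k := d k)) (b k)"
    unfolding prod unfolding b(1) d(1) entry psubst_affine[OF b(3) UV_polys[OF b(2)]]
    by (simp add: mult.commute)
qed

theorem theorem4p5:
  fixes n :: nat
  assumes "n > 1"
  shows "monoid (MT n :: 'a::comm_ring_1 tuple monoid) \<and>
    (monoid (elementary_product n :: ('a mpoly, 'a tuple) tower monoid) \<and>
      (MT n :: 'a tuple monoid) \<cong> (elementary_product n :: ('a mpoly, 'a tuple) tower monoid)) \<and>
    (monoid (affine_product n :: ('a mpoly, 'a mpoly \<times> 'a mpoly) tower monoid) \<and>
      (MT n :: 'a tuple monoid) \<cong> (affine_product n :: ('a mpoly, 'a mpoly \<times> 'a mpoly) tower monoid))"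
proof -
  have "1 \<le> n" using assms by simp
  then show ?thesis
    unfolding elementary_product_def affine_product_def
    using monoid_MT elementary.product_MT affine.product_MT by blast
qed

end
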